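(* For every integer $q\ge 4$ put $m(q)=\binom q2$. Then for every integer $q\geq 4$ there exists a real number $\epsilon=\epsilon(q)$ with $0<\epsilon<1$ such that the value of $\Sigma_{1+\epsilon}$ in the degree sequence of $QS(m(q)+1,m(q))$ is strictly less than the value of $\Sigma_{1+\epsilon}$ in the degree sequence of $K_q\oplus\overline{K}_{m(q)+1-q}$.
   Context: For a real $\beta>0$ and a finite simple graph with degree sequence $d=(d_1,\dots,d_n)$, $\Sigma_\beta(d)=\sum_{i=1}^n d_i^{\beta}$. For $m\le n-1$, the quasi-star graph $QS(n,m)$ is isomorphic to the star $K_{1,m}$ together with $n-m-1$ isolated vertices. $G\oplus H$ is the disjoint union of $G$ and $H$, and $\overline{K}_s$ is the graph consisting of $s$ isolated vertices. *)

theory Defs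
  imports Complex_Main "HOL-Library.Multiset" "Graph_Theory.Graph_Theory"
begin

text \<open>
  A finite simple graph is a \<^locale>\<open>pair_graph\<close>: every undirected edge
  \<open>uv\<close> is the pair of arcs \<open>(u, v)\<close> and \<open>(v, u)\<close>, so the degree of a vertex
  is its out-degree.
\<close>

definition degree_sequence :: "'a pair_pre_digraph \<Rightarrow> nat list" where
  "degree_sequence G =
     rev (sorted_list_of_multiset (image_mset (out_degree (with_proj G)) (mset_set (pverts G))))"

text \<open>Used for \<open>\<beta> > 0\<close>, where \<open>0 powr \<beta> = 0\<close> is the usual value of \<open>0\<close> to the power \<open>\<beta>\<close>.\<close>

definition degree_power_sum :: "real \<Rightarrow> nat list \<Rightarrow> real" where
  "degree_power_sum \<beta> d = (\<Sum>i<length d. real (d ! i) powr \<beta>)"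

definition complete_graph :: "nat \<Rightarrow> nat pair_pre_digraph" where
  "complete_graph q = \<lparr> pverts = {..<q}, parcs = {(u, v). u < q \<and> v < q \<and> u \<noteq> v} \<rparr>"

definition isolated_vertices :: "nat \<Rightarrow> nat pair_pre_digraph" where
  "isolated_vertices s = \<lparr> pverts = {..<s}, parcs = {} \<rparr>"

definition complete_bipartite_graph :: "nat \<Rightarrow> nat \<Rightarrow> (nat + nat) pair_pre_digraph" where
  "complete_bipartite_graph s t =
     \<lparr> pverts = {..<s} <+> {..<t},
       parcs = (Inl ` {..<s}) \<times> (Inr ` {..<t}) \<union> (Inr ` {..<t}) \<times> (Inl ` {..<s}) \<rparr>"

definition disjoint_union ::
  "'a pair_pre_digraph \<Rightarrow> 'b pair_pre_digraph \<Rightarrow> ('a + 'b) pair_pre_digraph" where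
  "disjoint_union G H =
     \<lparr> pverts = pverts G <+> pverts H,
       parcs = map_prod Inl Inl ` parcs G \<union> map_prod Inr Inr ` parcs H \<rparr>"

text \<open>
  Meaningful for \<open>m \<le> n - 1\<close> only; for more edges the quasi-star graph has several
  dominating vertices and is not given by this definition.
\<close>

definition quasi_star :: "nat \<Rightarrow> nat \<Rightarrow> ((nat + nat) + nat) pair_pre_digraph" where
  "quasi_star n m = disjoint_union (complete_bipartite_graph 1 m) (isolated_vertices (n - m - 1))"

lemma complete_graph_complete: "complete_digraph q (with_proj (complete_graph q))"
  unfolding complete_digraph_pair_def by (auto simp: complete_graph_def)

lemma complete_bipartite_graph_complete_bipartite:
  "complete_bipartite_digraph s t (with_proj (complete_bipartite_graph s t))"
  unfolding complete_bipartite_digraph_pair_def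
  by (intro conjI exI[of _ "Inl ` {..<s}"] exI[of _ "Inr ` {..<t}"])
     (auto simp: complete_bipartite_graph_def Plus_def card_image)

lemma pair_graph_complete_graph: "pair_graph (complete_graph q)"
  by (rule pair_graphI_complete[OF complete_graph_complete])

lemma pair_graph_complete_bipartite_graph: "pair_graph (complete_bipartite_graph s t)"
  by (rule pair_graphI_complete_bipartite[OF complete_bipartite_graph_complete_bipartite])

lemma pair_graph_isolated_vertices: "pair_graph (isolated_vertices s)"
  by unfold_locales (auto simp: isolated_vertices_def symmetric_def sym_def)

lemma pair_graph_disjoint_union:
  assumes "pair_graph G" "pair_graph H"
  shows "pair_graph (disjoint_union G H)"
proof -
  interpret G: pair_graph G by fact
  interpret H: pair_graph H by fact
  show ?thesis
    using G.pair_sym_arcs H.pair_sym_arcs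
      G.pair_finite_verts G.pair_finite_arcs H.pair_finite_verts H.pair_finite_arcs
    by unfold_locales
       (auto simp: disjoint_union_def symmetric_def sym_def
         dest: G.in_arcsD1 G.in_arcsD2 H.in_arcsD1 H.in_arcsD2 G.pair_no_loops H.pair_no_loops)
qed

lemma pair_graph_quasi_star: "pair_graph (quasi_star n m)"
  unfolding quasi_star_def
  by (intro pair_graph_disjoint_union pair_graph_complete_bipartite_graph
      pair_graph_isolated_vertices)

lemma card_pverts_quasi_star: "m < n \<Longrightarrow> card (pverts (quasi_star n m)) = n"
  by (simp add: quasi_star_def disjoint_union_def complete_bipartite_graph_def
      isolated_vertices_def card_Plus)

end

theory Submission
  imports Defs
begin

text \<open>
  Put \<open>m = q choose 2\<close>. The two sums are \<open>m powr (1 + \<epsilon>) + m\<close> and \<open>q * (q - 1) powr (1 + \<epsilon>)\<close>.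
  At \<open>\<epsilon> = 0\<close> both equal \<open>2 * m\<close> (twice the number of edges), and their derivatives there are
  \<open>m * ln m\<close> and \<open>m * ln ((q - 1)\<^sup>2)\<close>, of which the second is larger because \<open>m < (q - 1)\<^sup>2\<close>.
\<close>

text \<open>A power sum depends only on the multiset of its entries, so the sorting and reversal
  drop out and degrees can be summed vertex by vertex.\<close>

lemma degree_power_sum_degree_sequence:
  "degree_power_sum \<beta> (degree_sequence G) =
     (\<Sum>v\<in>pverts G. real (out_degree (with_proj G) v) powr \<beta>)"
proof -
  have "degree_power_sum \<beta> d = (\<Sum>x\<in>#mset d. real x powr \<beta>)" for d
    using sum_mset_sum_list[of "map (\<lambda>x. real x powr \<beta>) d"]
    by (simp add: degree_power_sum_def sum_list_sum_nth atLeast0LessThan)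
  then show ?thesis
    by (simp add: degree_sequence_def sum_unfold_sum_mset image_mset.compositionality o_def)
qed

text \<open>The arcs leaving \<open>v\<close> correspond to their heads through the injection
  \<open>Pair v\<close>; for the concrete graphs below, these neighbour sets are explicit.\<close>

lemma out_degree_with_proj: "out_degree (with_proj G) v = card {w. (v, w) \<in> parcs G}"
proof -
  have "out_arcs (with_proj G) v = Pair v ` {w. (v, w) \<in> parcs G}"
    by (auto simp: out_arcs_def)
  then show ?thesis
    by (simp add: out_degree_def card_image inj_on_def)
qed

lemma out_degree_disjoint_union_Inl:
  "out_degree (with_proj (disjoint_union G H)) (Inl u) = out_degree (with_proj G) u"
proof -
  have "{w. (Inl u, w) \<in> parcs (disjoint_union G H)} = Inl ` {w. (u, w) \<in> parcs G}"
    by (force simp: disjoint_union_def)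
  then show ?thesis
    by (simp add: out_degree_with_proj card_image)
qed

lemma out_degree_disjoint_union_Inr:
  "out_degree (with_proj (disjoint_union G H)) (Inr u) = out_degree (with_proj H) u"
proof -
  have "{w. (Inr u, w) \<in> parcs (disjoint_union G H)} = Inr ` {w. (u, w) \<in> parcs H}"
    by (force simp: disjoint_union_def)
  then show ?thesis
    by (simp add: out_degree_with_proj card_image)
qed

lemma degree_power_sum_disjoint_union:
  assumes "finite (pverts G)" "finite (pverts H)"
  shows "degree_power_sum \<beta> (degree_sequence (disjoint_union G H)) =
    degree_power_sum \<beta> (degree_sequence G) + degree_power_sum \<beta> (degree_sequence H)"
proof -
  have "pverts (disjoint_union G H) = pverts G <+> pverts H"
    by (simp add: disjoint_union_def)
  then show ?thesis
    using assms by (simp add: degree_power_sum_degree_sequence sum.Plus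
        out_degree_disjoint_union_Inl out_degree_disjoint_union_Inr)
qed

text \<open>All degrees are 0, and \<open>0 powr \<beta>\<close> is 0 by convention, even at
  exponent 0.\<close>

lemma degree_power_sum_isolated_vertices:
  "degree_power_sum \<beta> (degree_sequence (isolated_vertices s)) = 0"
  by (simp add: degree_power_sum_degree_sequence out_degree_with_proj isolated_vertices_def)

lemma degree_power_sum_complete_graph:
  "degree_power_sum \<beta> (degree_sequence (complete_graph q)) = real q * real (q - 1) powr \<beta>"
proof -
  have "out_degree (with_proj (complete_graph q)) u = q - 1" if "u < q" for u
  proof -
    have "{w. (u, w) \<in> parcs (complete_graph q)} = {..<q} - {u}"
      using that by (auto simp: complete_graph_def)
    then show ?thesis
      using that by (simp add: out_degree_with_proj)
  qed
  moreover have "pverts (complete_graph q) = {..<q}"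
    by (simp add: complete_graph_def)
  ultimately show ?thesis
    \<comment> \<open>For \<open>q = 0\<close> both sides vanish; otherwise \<open>q - 1\<close> is
      a genuine predecessor.\<close>
    by (cases q) (simp_all add: degree_power_sum_degree_sequence)
qed

lemma degree_power_sum_complete_bipartite_graph:
  "degree_power_sum \<beta> (degree_sequence (complete_bipartite_graph s t)) =
    real s * real t powr \<beta> + real t * real s powr \<beta>"
proof -
  have "out_degree (with_proj (complete_bipartite_graph s t)) (Inl u) = t" if "u < s" for u
  proof -
    have "{w. (Inl u, w) \<in> parcs (complete_bipartite_graph s t)} = Inr ` {..<t}"
      using that by (auto simp: complete_bipartite_graph_def)
    then show ?thesis
      by (simp add: out_degree_with_proj card_image)
  qed
  moreover have "out_degree (with_proj (complete_bipartite_graph s t)) (Inr u) = s" if "u < t" for u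
  proof -
    have "{w. (Inr u, w) \<in> parcs (complete_bipartite_graph s t)} = Inl ` {..<s}"
      using that by (auto simp: complete_bipartite_graph_def)
    then show ?thesis
      by (simp add: out_degree_with_proj card_image)
  qed
  moreover have "pverts (complete_bipartite_graph s t) = {..<s} <+> {..<t}"
    by (simp add: complete_bipartite_graph_def)
  ultimately show ?thesis
    by (simp add: degree_power_sum_degree_sequence sum.Plus)
qed

text \<open>The centre of the star has degree \<open>m\<close> and each of its \<open>m\<close>
  leaves has degree 1; the isolated vertices add nothing, so \<open>n\<close> disappears.\<close>

lemma degree_power_sum_quasi_star:
  "degree_power_sum \<beta> (degree_sequence (quasi_star n m)) = real m powr \<beta> + real m"
proof -
  have "finite (pverts (complete_bipartite_graph 1 m))" "finite (pverts (isolated_vertices (n - m - 1)))"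
    by (simp_all add: complete_bipartite_graph_def isolated_vertices_def)
  then show ?thesis
    by (simp add: quasi_star_def degree_power_sum_disjoint_union
        degree_power_sum_complete_bipartite_graph degree_power_sum_isolated_vertices)
qed

text \<open>With \<open>a = q - 1\<close> and \<open>2 * m = q * a\<close>, this is the comparison
  of the two sums after division by \<open>m\<close>.\<close>

lemma ex_powr_less_of_less_square:
  fixes a m :: real
  assumes "0 < m" "0 < a" "m < a\<^sup>2"
  shows "\<exists>\<epsilon>. 0 < \<epsilon> \<and> \<epsilon> < 1 \<and> m powr \<epsilon> + 1 < 2 * a powr \<epsilon>"
proof -
  define f where "f = (\<lambda>\<epsilon>. 2 * a powr \<epsilon> - m powr \<epsilon>)"
  have "(f has_real_derivative 2 * ln a - ln m) (at 0)"
    unfolding f_def using assms by (auto intro!: derivative_eq_intros)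
  moreover have "ln m < ln (a\<^sup>2)"
    using assms by (subst ln_less_cancel_iff) auto
  then have "0 < 2 * ln a - ln m"
    using assms by (simp add: ln_realpow)
  ultimately obtain d where d: "0 < d" "\<And>h. 0 < h \<Longrightarrow> h < d \<Longrightarrow> f 0 < f (0 + h)"
    using DERIV_pos_inc_right by blast
  \<comment> \<open>Halving the minimum makes \<epsilon> strictly smaller than both \<open>d\<close>
    and 1.\<close>
  define \<epsilon> where "\<epsilon> = min d 1 / 2"
  have "0 < \<epsilon>" "\<epsilon> < d" "\<epsilon> < 1"
    using d(1) by (auto simp: \<epsilon>_def)
  \<comment> \<open>Since \<open>f 0 = 2 - 1 = 1\<close>, the inequality
    \<open>f 0 < f \<epsilon>\<close> is the claim rearranged.\<close>
  moreover from d(2)[OF this(1,2)] have "m powr \<epsilon> + 1 < 2 * a powr \<epsilon>"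
    using assms by (simp add: f_def)
  ultimately show ?thesis
    by blast
qed

theorem theorem9:
  fixes q :: nat
  assumes "q \<ge> 4"
  shows "\<exists>\<epsilon>::real. 0 < \<epsilon> \<and> \<epsilon> < 1 \<and>
    degree_power_sum (1 + \<epsilon>)
      (degree_sequence (quasi_star ((q choose 2) + 1) (q choose 2))) <
    degree_power_sum (1 + \<epsilon>)
      (degree_sequence
        (disjoint_union (complete_graph q) (isolated_vertices ((q choose 2) + 1 - q))))"
proof -
  define m where "m = real (q choose 2)"
  define a where "a = real (q - 1)"
  have a: "real q = a + 1" "3 \<le> a"
    using assms by (auto simp: a_def)
  have "2 * (q choose 2) = q * (q - 1)"
    \<comment> \<open>The formula \<open>choose_two\<close> contains an integer division by 2, which
      is exact because \<open>q * (q - 1)\<close> is even.\<close>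
    by (cases q) (simp_all add: choose_two)
  then have m: "2 * m = real q * a"
    unfolding m_def a_def by (metis of_nat_mult of_nat_numeral)
  \<comment> \<open>As \<open>a > 1\<close>, \<open>2 * m = a * a + a\<close> lies strictly below
    \<open>2 * (a * a)\<close>, which gives the bound on \<open>m\<close>.\<close>
  have "a * 1 < a * a"
    using a by (intro mult_strict_left_mono) auto
  moreover have "2 * m = a * a + a"
    using m a(1) by (simp add: distrib_right)
  ultimately have "m < a\<^sup>2"
    unfolding power2_eq_square by linarith
  moreover have "0 < real q * a"
    using a by simp
  then have "0 < m"
    using m by linarith
  ultimately obtain \<epsilon> where \<epsilon>: "0 < \<epsilon>" "\<epsilon> < 1" "m powr \<epsilon> + 1 < 2 * a powr \<epsilon>"
    using ex_powr_less_of_less_square[of m a] a by auto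
  have "m powr (1 + \<epsilon>) + m = m * (m powr \<epsilon> + 1)"
    using \<open>0 < m\<close> by (simp add: powr_add algebra_simps)
  also have "\<dots> < m * (2 * a powr \<epsilon>)"
    using \<epsilon>(3) \<open>0 < m\<close> by simp
  \<comment> \<open>Replacing \<open>2 * m\<close> by \<open>q * a\<close> supplies the extra factor
    \<open>a\<close> that raises the exponent to \<open>1 + \<epsilon>\<close>.\<close>
  also have "\<dots> = real q * a powr (1 + \<epsilon>)"
    using m a by (simp add: powr_add)
  finally have "m powr (1 + \<epsilon>) + m < real q * a powr (1 + \<epsilon>)" .
  moreover have "finite (pverts (complete_graph q))" "finite (pverts (isolated_vertices s))" for s
    by (simp_all add: complete_graph_def isolated_vertices_def)
  ultimately show ?thesis
    using \<epsilon>(1,2)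
    by (auto simp: degree_power_sum_quasi_star degree_power_sum_disjoint_union
        degree_power_sum_complete_graph degree_power_sum_isolated_vertices m_def a_def)
qed

end
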